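(* Let $g,b,z_d\in\mathbb{R}$, $M_2>0$ and $\alpha>0$. Let $q_{\alpha_{op}}$ be the minimizer of $J_{2\alpha}$ over $\mathbb{R}$ and, for $h=x_0/n$ with $n\ge1$ an integer, let $q^h_{\alpha_{op}}$ be the minimizer of $J^h_{2\alpha}$ over $\mathbb{R}$. Put $D_{1\alpha}=\tfrac13+\tfrac1{\alpha x_0}+\tfrac1{\alpha^2x_0^2}$. (a) $$q^h_{\alpha_{op}}=q_{\alpha_{op}}-B_{1\alpha}\frac{gh}6-B_{2\alpha}\frac{gh^2}{24x_0},$$ with $B_{1\alpha}=\left(1+\tfrac9{2\alpha x_0}+\tfrac6{\alpha^2x_0^2}\right)\left(D_{1\alpha}+\tfrac{M_2}{x_0^3}\right)^{-1}$ and $B_{2\alpha}=\left(1+\tfrac2{\alpha x_0}\right)\left(D_{1\alpha}+\tfrac{M_2}{x_0^3}\right)^{-1}$. (b) There are constants $C_{8\alpha},C_{9\alpha}$ not depending on $h$ such that, as $h\to0$ ($h=x_0/n$, $n\to\infty$), $$|q^h_{\alpha_{op}}-q_{\alpha_{op}}|=C_{8\alpha}h+o(h),\qquad|J^h_{2\alpha}(q^h_{\alpha_{op}})-J_{2\alpha}(q_{\alpha_{op}})|=C_{9\alpha}h+o(h).$$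
   Context: Fix $x_0,y_0>0$, $\Omega=(0,x_0)\times(0,y_0)$, $\Gamma_2=\{x_0\}\times(0,y_0]$, $H=L^2(\Omega)$, $Q=L^2(\Gamma_2)$ with their standard norms. For constants $g,q,b\in\mathbb{R}$ and $\alpha>0$, the system $-\Delta u=g$ in $\Omega$, $-\partial u/\partial n=\alpha(u-b)$ on $\{0\}\times(0,y_0]$, $-\partial u/\partial n=q$ on $\Gamma_2$, $-\partial u/\partial n=0$ on $[0,x_0]\times\{0,y_0\}$ has solution $u_{\alpha q}(x,y)=-\tfrac12gx^2+(gx_0-q)x+\tfrac1\alpha(gx_0-q)+b$. For an integer $n\ge1$, $h=x_0/n$, $x_i=(i-1)h$, its discrete (finite-difference, piecewise linear) approximation is $u^h_{\alpha q}(x,y)=(gx_0-q-hgi)x+b+\tfrac{gx_0-q}\alpha-\tfrac{gh}\alpha+\tfrac{i^2-i}2gh^2$ for $x\in[x_i,x_{i+1}]$, $y\in[0,y_0]$, $i=1,\dots,n$. For fixed $g,b,z_d\in\mathbb{R}$ and $M_2>0$ the cost functions on $\mathbb{R}$ are $J_{2\alpha}(q)=\tfrac12\|u_{\alpha q}-z_d\|_H^2+\tfrac{M_2}2\|q\|_Q^2$ and $J^h_{2\alpha}(q)=\tfrac12\|u^h_{\alpha q}-z_d\|_H^2+\tfrac{M_2}2\|q\|_Q^2$, where $\|q\|_Q^2=y_0q^2$ for constant $q$. The minimizer of $J_{2\alpha}$ is $q_{\alpha_{op}}=-\dfrac{D_{2\alpha}gx_0^2+D_{3\alpha}(b-z_d)}{2x_0\left(D_{1\alpha}+\frac{M_2}{x_0^3}\right)}$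 with $D_{1\alpha}=\tfrac13+\tfrac1{\alpha x_0}+\tfrac1{\alpha^2x_0^2}$, $D_{2\alpha}=-\tfrac5{12}-\tfrac5{3\alpha x_0}-\tfrac2{\alpha^2x_0^2}$, $D_{3\alpha}=-1-\tfrac2{\alpha x_0}$. *)

theory Defs
  imports "HOL-Analysis.Analysis" "HOL-Library.Landau_Symbols"
begin

definition domain_Omega :: "real \<Rightarrow> real \<Rightarrow> (real \<times> real) set" where
  "domain_Omega x0 y0 = {0<..<x0} \<times> {0<..<y0}"

definition norm_H :: "real \<Rightarrow> real \<Rightarrow> (real \<times> real \<Rightarrow> real) \<Rightarrow> real" where
  "norm_H x0 y0 f = sqrt (set_lebesgue_integral lborel (domain_Omega x0 y0) (\<lambda>p. (f p)\<^sup>2))"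

(* The norm of L^2 on the boundary part {x0} \<times> (0, y0], with arc length as the measure. *)
definition norm_Q :: "real \<Rightarrow> real \<Rightarrow> (real \<times> real \<Rightarrow> real) \<Rightarrow> real" where
  "norm_Q x0 y0 f = sqrt (set_lebesgue_integral lborel {0<..y0} (\<lambda>y. (f (x0, y))\<^sup>2))"

lemma norm_Q_const:
  assumes "y0 > 0"
  shows "(norm_Q x0 y0 (\<lambda>_. q))\<^sup>2 = y0 * q\<^sup>2"
  using assms by (simp add: norm_Q_def set_lebesgue_integral_def)

(* The explicit solution of the mixed boundary value problem; see state_solves_system. *)
definition state :: "real \<Rightarrow> real \<Rightarrow> real \<Rightarrow> real \<Rightarrow> real \<Rightarrow> real \<times> real \<Rightarrow> real" where
  "state x0 g b \<alpha> q = (\<lambda>(x, y).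
     - (1/2) * g * x\<^sup>2 + (g * x0 - q) * x + (1/\<alpha>) * (g * x0 - q) + b)"

(* The outward normal is (-1, 0) on the left edge, (1, 0) on the right edge
   and (0, -1), (0, 1) on the bottom and top edges. *)
lemma state_solves_system:
  assumes "\<alpha> > 0"
  shows "- (deriv (\<lambda>s. deriv (\<lambda>r. state x0 g b \<alpha> q (r, y)) s) x
            + deriv (\<lambda>s. deriv (\<lambda>r. state x0 g b \<alpha> q (x, r)) s) y) = g"
    and "deriv (\<lambda>r. state x0 g b \<alpha> q (r, y)) 0 = \<alpha> * (state x0 g b \<alpha> q (0, y) - b)"
    and "- deriv (\<lambda>r. state x0 g b \<alpha> q (r, y)) x0 = q"
    and "deriv (\<lambda>r. state x0 g b \<alpha> q (x, r)) y = 0"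
proof -
  have dx: "deriv (\<lambda>r. state x0 g b \<alpha> q (r, y)) s = - g * s + (g * x0 - q)" for s y
    unfolding state_def prod.case
    by (rule DERIV_imp_deriv) (auto intro!: derivative_eq_intros)
  have dxx: "deriv (\<lambda>s. - g * s + (g * x0 - q)) x = - g"
    by (rule DERIV_imp_deriv) (auto intro!: derivative_eq_intros)
  have dy: "deriv (\<lambda>r. state x0 g b \<alpha> q (x, r)) s = 0" for s x
    by (simp add: state_def)
  show "- (deriv (\<lambda>s. deriv (\<lambda>r. state x0 g b \<alpha> q (r, y)) s) x
            + deriv (\<lambda>s. deriv (\<lambda>r. state x0 g b \<alpha> q (x, r)) s) y) = g"
    unfolding dx dy dxx by simp
  show "deriv (\<lambda>r. state x0 g b \<alpha> q (r, y)) 0 = \<alpha> * (state x0 g b \<alpha> q (0, y) - b)"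
    unfolding dx using assms by (simp add: state_def)
  show "- deriv (\<lambda>r. state x0 g b \<alpha> q (r, y)) x0 = q"
    unfolding dx by (simp add: algebra_simps)
  show "deriv (\<lambda>r. state x0 g b \<alpha> q (x, r)) y = 0"
    by (rule dy)
qed

definition mesh :: "real \<Rightarrow> nat \<Rightarrow> real" where
  "mesh x0 n = x0 / real n"

definition node :: "real \<Rightarrow> nat \<Rightarrow> nat \<Rightarrow> real" where
  "node x0 n i = (real i - 1) * mesh x0 n"

definition discrete_piece ::
  "real \<Rightarrow> real \<Rightarrow> real \<Rightarrow> real \<Rightarrow> real \<Rightarrow> real \<Rightarrow> nat \<Rightarrow> real \<Rightarrow> real" where
  "discrete_piece x0 g b \<alpha> q h i x =
     (g * x0 - q - h * g * real i) * x + b + (g * x0 - q) / \<alpha> - g * h / \<alpha>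
     + ((real i)\<^sup>2 - real i) / 2 * g * h\<^sup>2"

(* Neighbouring pieces agree at the common node, so the choice of the least index is immaterial
   (discrete_state_on_cell). The value is unspecified for x outside the interval [0, x0]. *)
definition discrete_state ::
  "real \<Rightarrow> real \<Rightarrow> real \<Rightarrow> real \<Rightarrow> real \<Rightarrow> nat \<Rightarrow> real \<times> real \<Rightarrow> real" where
  "discrete_state x0 g b \<alpha> q n = (\<lambda>(x, y).
     discrete_piece x0 g b \<alpha> q (mesh x0 n)
       (LEAST i. i \<in> {1..n} \<and> x \<in> {node x0 n i..node x0 n (i + 1)}) x)"

lemma discrete_state_on_cell:
  assumes "x0 > 0" "n \<ge> 1" "i \<in> {1..n}" "x \<in> {node x0 n i..node x0 n (i + 1)}"
  shows "discrete_state x0 g b \<alpha> q n (x, y) = discrete_piece x0 g b \<alpha> q (mesh x0 n) i x"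
proof -
  define P where "P = (\<lambda>k. k \<in> {1..n} \<and> x \<in> {node x0 n k..node x0 n (k + 1)})"
  define j where "j = (LEAST k. P k)"
  have h: "mesh x0 n > 0" using assms by (simp add: mesh_def)
  have Pi: "P i" using assms by (simp add: P_def)
  have Pj: "P j" unfolding j_def by (rule LeastI[of P, OF Pi])
  have ji: "j \<le> i" unfolding j_def by (rule Least_le[of P, OF Pi])
  have "node x0 n i \<le> node x0 n (j + 1)" using Pi Pj by (auto simp: P_def)
  hence "real i - 1 \<le> real j"
    using h by (simp add: node_def)
  hence "i = j \<or> i = j + 1" using ji by linarith
  hence "discrete_piece x0 g b \<alpha> q (mesh x0 n) j x = discrete_piece x0 g b \<alpha> q (mesh x0 n) i x"
  proof
    assume i: "i = j + 1"
    have "x = real j * mesh x0 n" using Pi Pj i by (auto simp: P_def node_def)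
    thus ?thesis unfolding i discrete_piece_def by (simp add: power2_eq_square field_simps)
  qed simp
  thus ?thesis by (simp add: discrete_state_def j_def P_def)
qed

definition cost ::
  "real \<Rightarrow> real \<Rightarrow> real \<Rightarrow> real \<Rightarrow> real \<Rightarrow> real \<Rightarrow> real \<Rightarrow> real \<Rightarrow> real" where
  "cost x0 y0 g b z M \<alpha> q =
     1/2 * (norm_H x0 y0 (\<lambda>p. state x0 g b \<alpha> q p - z))\<^sup>2
     + M/2 * (norm_Q x0 y0 (\<lambda>_. q))\<^sup>2"

definition discrete_cost ::
  "real \<Rightarrow> real \<Rightarrow> real \<Rightarrow> real \<Rightarrow> real \<Rightarrow> real \<Rightarrow> real \<Rightarrow> nat \<Rightarrow> real \<Rightarrow> real" where
  "discrete_cost x0 y0 g b z M \<alpha> n q =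
     1/2 * (norm_H x0 y0 (\<lambda>p. discrete_state x0 g b \<alpha> q n p - z))\<^sup>2
     + M/2 * (norm_Q x0 y0 (\<lambda>_. q))\<^sup>2"

(* Unspecified unless J has exactly one global minimizer. *)
definition the_minimizer :: "(real \<Rightarrow> real) \<Rightarrow> real" where
  "the_minimizer J = (THE q. is_arg_min J (\<lambda>_. True) q)"

definition opt_flux ::
  "real \<Rightarrow> real \<Rightarrow> real \<Rightarrow> real \<Rightarrow> real \<Rightarrow> real \<Rightarrow> real \<Rightarrow> real" where
  "opt_flux x0 y0 g b z M \<alpha> = the_minimizer (cost x0 y0 g b z M \<alpha>)"

definition discrete_opt_flux ::
  "real \<Rightarrow> real \<Rightarrow> real \<Rightarrow> real \<Rightarrow> real \<Rightarrow> real \<Rightarrow> real \<Rightarrow> nat \<Rightarrow> real" where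
  "discrete_opt_flux x0 y0 g b z M \<alpha> n = the_minimizer (discrete_cost x0 y0 g b z M \<alpha> n)"

definition D1 :: "real \<Rightarrow> real \<Rightarrow> real" where
  "D1 x0 \<alpha> = 1/3 + 1 / (\<alpha> * x0) + 1 / (\<alpha>\<^sup>2 * x0\<^sup>2)"

definition B1 :: "real \<Rightarrow> real \<Rightarrow> real \<Rightarrow> real" where
  "B1 x0 M \<alpha> = (1 + 9 / (2 * \<alpha> * x0) + 6 / (\<alpha>\<^sup>2 * x0\<^sup>2)) * inverse (D1 x0 \<alpha> + M / x0 ^ 3)"

definition B2 :: "real \<Rightarrow> real \<Rightarrow> real \<Rightarrow> real" where
  "B2 x0 M \<alpha> = (1 + 2 / (\<alpha> * x0)) * inverse (D1 x0 \<alpha> + M / x0 ^ 3)"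

end

theory Submission
  imports Defs
begin

text \<open>
  Both states are affine in the control with the same slope: on \<open>\<Omega>\<close> they are
  \<open>z + r(x) - q w(x)\<close> and \<open>z + r(x) - g e(x) - q w(x)\<close>, where \<open>w(x) = x + 1/\<alpha>\<close>, \<open>r\<close> does not
  depend on \<open>q\<close> and \<open>g e\<close> is the gap between the continuous and the discrete state. Hence each
  cost is a quadratic polynomial \<open>y0/2 (A - 2 q F + q\<^sup>2 S)\<close> (\<open>tracking_cost_expand\<close>) with minimizer
  \<open>F/S\<close> and minimum \<open>y0/2 (A - F\<^sup>2/S)\<close> (\<open>quadratic_arg_min\<close>). The leading coefficient
  \<open>S = \<integral> w\<^sup>2 + M = x0\<^sup>3 (D\<^sub>1 + M/x0\<^sup>3)\<close> is common to both, so the discrete optimal control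
  is the continuous one plus \<open>- g/S \<integral> e w\<close>.

  The key is the shape of \<open>e\<close>. Completing the square in a mesh cell with \<open>t\<close> the distance to its
  left end gives \<open>e = h (x/2 + 1/\<alpha>) + t (h - t)/2\<close> (\<open>discrete_state_minus_target\<close>): a drift of
  exact order \<open>h\<close> and a bubble which vanishes at the nodes. The moment of the drift against \<open>w\<close>
  yields \<open>B\<^sub>1\<close>. In every cell the bubble is symmetric about the midpoint with mean \<open>h\<^sup>2/12\<close>, so
  against an affine function it acts like the constant \<open>h\<^sup>2/12\<close>
  (\<open>has_integral_cell_bubble_moment\<close>); this yields \<open>B\<^sub>2\<close>, with no higher powers of \<open>h\<close>.

  For the orders of convergence it remains to expand \<open>A\<close>, which is needed only to first order:
  there the bubble may be estimated by its maximum \<open>h\<^sup>2/8\<close> (\<open>perturbed_integral_square\<close>). A quantity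
  \<open>c h + O(h\<^sup>2)\<close> has absolute value \<open>\<bar>c\<bar> h + o(h)\<close> (\<open>abs_first_order_smallo\<close>).
\<close>

section \<open>Integrals of bounded measurable functions on an interval\<close>

abbreviation integral_Ioo :: "real \<Rightarrow> (real \<Rightarrow> real) \<Rightarrow> real" where
  "integral_Ioo a \<phi> \<equiv> (LINT x:{0<..<a}|lborel. \<phi> x)"

text \<open>
  A class of integrands that is an algebra, so that integrability of products never needs a
  separate argument. Measurability is the right demand since the bubble below is written with \<open>frac\<close>.
\<close>
definition bounded_measurable :: "real \<Rightarrow> (real \<Rightarrow> real) \<Rightarrow> bool" where
  "bounded_measurable a \<phi> \<longleftrightarrow>
     \<phi> \<in> borel_measurable borel \<and> (\<exists>C. \<forall>x\<in>{0<..<a}. \<bar>\<phi> x\<bar> \<le> C)"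

lemma bounded_measurable_const: "bounded_measurable a (\<lambda>_. c)"
  by (auto simp: bounded_measurable_def)

lemma bounded_measurable_ident: "bounded_measurable a (\<lambda>x. x)"
  by (auto simp: bounded_measurable_def intro!: exI[of _ a])

lemma bounded_measurable_add:
  assumes "bounded_measurable a \<phi>" "bounded_measurable a \<psi>"
  shows "bounded_measurable a (\<lambda>x. \<phi> x + \<psi> x)"
proof -
  obtain C D where "\<forall>x\<in>{0<..<a}. \<bar>\<phi> x\<bar> \<le> C" "\<forall>x\<in>{0<..<a}. \<bar>\<psi> x\<bar> \<le> D"
    using assms by (auto simp: bounded_measurable_def)
  hence "\<forall>x\<in>{0<..<a}. \<bar>\<phi> x + \<psi> x\<bar> \<le> C + D"
    by (meson abs_triangle_ineq add_mono order_trans)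
  thus ?thesis using assms by (auto simp: bounded_measurable_def)
qed

lemma bounded_measurable_mult:
  assumes "bounded_measurable a \<phi>" "bounded_measurable a \<psi>"
  shows "bounded_measurable a (\<lambda>x. \<phi> x * \<psi> x)"
proof -
  obtain C D where "\<forall>x\<in>{0<..<a}. \<bar>\<phi> x\<bar> \<le> C" "\<forall>x\<in>{0<..<a}. \<bar>\<psi> x\<bar> \<le> D"
    using assms by (auto simp: bounded_measurable_def)
  hence "\<forall>x\<in>{0<..<a}. \<bar>\<phi> x * \<psi> x\<bar> \<le> C * D"
    by (auto simp: abs_mult intro!: mult_mono order_trans[OF abs_ge_zero])
  thus ?thesis using assms by (auto simp: bounded_measurable_def)
qed

lemma bounded_measurable_diff:
  assumes "bounded_measurable a \<phi>" "bounded_measurable a \<psi>"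
  shows "bounded_measurable a (\<lambda>x. \<phi> x - \<psi> x)"
  using bounded_measurable_add[OF assms(1)
      bounded_measurable_mult[OF bounded_measurable_const[of a "-1"] assms(2)]] by simp

lemma bounded_measurable_power:
  assumes "bounded_measurable a \<phi>"
  shows "bounded_measurable a (\<lambda>x. \<phi> x ^ k)"
  by (induction k) (auto intro: bounded_measurable_const bounded_measurable_mult assms)

lemmas bounded_measurable_intros =
  bounded_measurable_const bounded_measurable_ident bounded_measurable_add
  bounded_measurable_diff bounded_measurable_mult bounded_measurable_power

lemma set_integrable_bounded_measurable:
  assumes "bounded_measurable a \<phi>"
  shows "set_integrable lborel {0<..<a} \<phi>"
proof -
  obtain C where "\<phi> \<in> borel_measurable borel" "\<forall>x\<in>{0<..<a}. \<bar>\<phi> x\<bar> \<le> C"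
    using assms by (auto simp: bounded_measurable_def)
  thus ?thesis unfolding set_integrable_def
    by (intro integrableI_bounded_set_indicator[where B = C])
       (auto intro: emeasure_bounded_finite[unfolded infinity_ennreal_def])
qed

lemma integral_Ioo_add_scaled:
  assumes "bounded_measurable a \<phi>" "bounded_measurable a \<psi>"
  shows "integral_Ioo a (\<lambda>x. \<phi> x + c * \<psi> x) = integral_Ioo a \<phi> + c * integral_Ioo a \<psi>"
  using assms by (simp add: set_integrable_bounded_measurable)

lemma integral_Ioo_eq_integral:
  assumes "bounded_measurable a \<phi>"
  shows "integral_Ioo a \<phi> = integral {0..a} \<phi>"
  using set_borel_integral_eq_integral(2)[OF set_integrable_bounded_measurable[OF assms]]
  by (simp add: integral_open_interval_real)

text \<open>
  Everything integrated over the rectangle depends on \<open>x\<close> alone, so by Fubini it is \<open>y0\<close> times an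
  integral over \<open>(0, x0)\<close>.
\<close>
lemma integral_Omega_fst:
  assumes "y0 > 0" "bounded_measurable x0 \<phi>"
  shows "(LINT p:domain_Omega x0 y0|lborel. \<phi> (fst p)) = y0 * integral_Ioo x0 \<phi>"
proof -
  obtain C where [measurable]: "\<phi> \<in> borel_measurable borel"
    and C: "\<forall>x\<in>{0<..<x0}. \<bar>\<phi> x\<bar> \<le> C"
    using assms by (auto simp: bounded_measurable_def)
  have Om: "domain_Omega x0 y0 \<in> sets (lborel \<Otimes>\<^sub>M lborel)"
    unfolding domain_Omega_def by measurable
  have "emeasure (lborel \<Otimes>\<^sub>M lborel) (domain_Omega x0 y0)
          = emeasure lborel {0<..<x0} * emeasure lborel {0<..<y0}"
    unfolding domain_Omega_def by (rule lborel.emeasure_pair_measure_Times) auto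
  also have "\<dots> < \<infinity>"
    using emeasure_bounded_finite[of "{0<..<x0}"] emeasure_bounded_finite[of "{0<..<y0}"]
    by (simp add: ennreal_mult_less_top)
  finally have int: "integrable (lborel \<Otimes>\<^sub>M lborel)
      (\<lambda>p. indicator (domain_Omega x0 y0) p *\<^sub>R \<phi> (fst p))"
    using Om C by (intro integrableI_bounded_set_indicator[where B = C])
      (auto simp: domain_Omega_def)
  have "(LINT p:domain_Omega x0 y0|lborel. \<phi> (fst p))
      = (LINT x|lborel. LINT y|lborel. indicator (domain_Omega x0 y0) (x, y) *\<^sub>R \<phi> x)"
    unfolding set_lebesgue_integral_def lborel_prod[symmetric]
    by (subst lborel_pair.integral_fst'[OF int, symmetric]) simp
  also have "\<dots> = (LINT x|lborel. indicator {0<..<x0} x *\<^sub>R \<phi> x * y0)"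
  proof (rule Bochner_Integration.integral_cong[OF refl])
    fix x
    have "(\<lambda>y. indicator (domain_Omega x0 y0) (x, y) *\<^sub>R \<phi> x)
        = (\<lambda>y. indicator {0<..<y0} y * (indicator {0<..<x0} x * \<phi> x))"
      by (auto simp: domain_Omega_def indicator_def fun_eq_iff)
    thus "(LINT y|lborel. indicator (domain_Omega x0 y0) (x, y) *\<^sub>R \<phi> x)
        = indicator {0<..<x0} x *\<^sub>R \<phi> x * y0"
      using assms(1) by simp
  qed
  finally show ?thesis by (simp add: set_lebesgue_integral_def)
qed

section \<open>Tracking costs as quadratic polynomials in the control\<close>

text \<open>
  Completing the square: \<open>J q = J (F/S) + c S (q - F/S)\<^sup>2\<close>, so the minimizer is unique and
  \<open>the_minimizer\<close> is meaningful.
\<close>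
lemma quadratic_arg_min:
  assumes "c > 0" "S > 0" and J: "\<And>q::real. J q = c * (A - 2 * q * F + q\<^sup>2 * S)"
  shows "the_minimizer J = F / S" "J (F / S) = c * (A - F\<^sup>2 / S)"
proof -
  have sq: "J q = J (F / S) + c * S * (q - F / S)\<^sup>2" for q
    using assms(2) unfolding J by (simp add: field_simps power2_eq_square)
  have "is_arg_min J (\<lambda>_. True) q \<longleftrightarrow> q = F / S" for q
  proof
    assume "is_arg_min J (\<lambda>_. True) q"
    hence "\<not> J (F / S) < J q" by (auto simp: is_arg_min_def)
    hence "c * S * (q - F / S)\<^sup>2 \<le> 0" using sq[of q] by linarith
    hence "(q - F / S)\<^sup>2 \<le> 0" using assms(1,2)
      by (simp add: mult_le_0_iff not_le[symmetric])
    thus "q = F / S" by simp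
  next
    assume q: "q = F / S"
    have "J q \<le> J p" for p
      unfolding q sq[of p] using assms(1,2) by simp
    thus "is_arg_min J (\<lambda>_. True) q" by (auto simp: is_arg_min_def not_less)
  qed
  thus "the_minimizer J = F / S" by (simp add: the_minimizer_def)
  show "J (F / S) = c * (A - F\<^sup>2 / S)"
    using assms(2) unfolding J by (simp add: field_simps power2_eq_square)
qed

text \<open>
  Stated for an arbitrary state of the form \<open>f - q w\<close>, to cover the continuous and the discrete
  problem at once.
\<close>
lemma tracking_cost_expand:
  assumes "y0 > 0" and f: "bounded_measurable x0 f" and w: "bounded_measurable x0 w"
    and u: "\<And>x y. (x, y) \<in> domain_Omega x0 y0 \<Longrightarrow> u (x, y) = f x - q * w x"
  shows "1/2 * (norm_H x0 y0 u)\<^sup>2 + M/2 * (norm_Q x0 y0 (\<lambda>_. q))\<^sup>2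
    = y0/2 * (integral_Ioo x0 (\<lambda>x. (f x)\<^sup>2) - 2 * q * integral_Ioo x0 (\<lambda>x. f x * w x)
        + q\<^sup>2 * (integral_Ioo x0 (\<lambda>x. (w x)\<^sup>2) + M))"
proof -
  note bm = bounded_measurable_intros f w
  have "(norm_H x0 y0 u)\<^sup>2 = (LINT p:domain_Omega x0 y0|lborel. (u p)\<^sup>2)"
    unfolding norm_H_def set_lebesgue_integral_def by (simp add: integral_nonneg_AE)
  also have "\<dots> = (LINT p:domain_Omega x0 y0|lborel. (f (fst p) - q * w (fst p))\<^sup>2)"
    unfolding set_lebesgue_integral_def
    by (rule Bochner_Integration.integral_cong) (auto simp: indicator_def u)
  also have "\<dots> = y0 * integral_Ioo x0 (\<lambda>x. (f x - q * w x)\<^sup>2)"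
    by (rule integral_Omega_fst[of y0 x0 "\<lambda>x. (f x - q * w x)\<^sup>2"])
       (intro assms(1) bm)+
  also have "(\<lambda>x. (f x - q * w x)\<^sup>2)
      = (\<lambda>x. ((f x)\<^sup>2 + (- 2 * q) * (f x * w x)) + q\<^sup>2 * (w x)\<^sup>2)"
    by (simp add: power2_eq_square algebra_simps)
  also have "integral_Ioo x0 \<dots> = integral_Ioo x0 (\<lambda>x. (f x)\<^sup>2)
      + (- 2 * q) * integral_Ioo x0 (\<lambda>x. f x * w x) + q\<^sup>2 * integral_Ioo x0 (\<lambda>x. (w x)\<^sup>2)"
    by (subst integral_Ioo_add_scaled, (intro bm)+)+ simp
  finally show ?thesis
    unfolding norm_Q_const[OF assms(1)] by (simp add: algebra_simps)
qed

section \<open>The bubble inside the mesh cells\<close>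

text \<open>
  In a cell of width \<open>h\<close> with \<open>t\<close> the distance to the left end this is \<open>t (h - t) / 2\<close>. Writing it
  with \<open>frac\<close> gives one formula for all cells, periodic and independent of the number of cells.
\<close>
definition cell_bubble :: "real \<Rightarrow> real \<Rightarrow> real" where
  "cell_bubble h x = h\<^sup>2 / 2 * (frac (x / h) * (1 - frac (x / h)))"

lemma cell_bubble_bounds: "0 \<le> cell_bubble h x" "cell_bubble h x \<le> h\<^sup>2 / 8"
proof -
  define t where "t = frac (x / h)"
  have t: "0 \<le> t" "t < 1" by (simp_all add: t_def frac_lt_1)
  show "0 \<le> cell_bubble h x" using t by (simp add: cell_bubble_def t_def)
  have "t * (1 - t) \<le> 1 / 4"
    using zero_le_power2[of "t - 1/2"] by (simp add: power2_eq_square algebra_simps)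
  hence "h\<^sup>2 / 2 * (t * (1 - t)) \<le> h\<^sup>2 / 2 * (1 / 4)" by (intro mult_left_mono) auto
  thus "cell_bubble h x \<le> h\<^sup>2 / 8" by (simp add: cell_bubble_def t_def)
qed

lemma bounded_measurable_cell_bubble: "bounded_measurable a (cell_bubble h)"
proof -
  have "cell_bubble h \<in> borel_measurable borel"
    unfolding cell_bubble_def[abs_def] frac_def by measurable
  thus ?thesis using cell_bubble_bounds[of h]
    by (auto simp: bounded_measurable_def intro!: exI[of _ "h\<^sup>2 / 8"])
qed

text \<open>
  The right end point, where \<open>frac\<close> has already jumped to 0, is included since the formula
  vanishes at both ends.
\<close>
lemma cell_bubble_on_cell:
  assumes "h > 0" "x \<in> {real k * h..real (Suc k) * h}"
  shows "cell_bubble h x = (x - real k * h) * (real (Suc k) * h - x) / 2"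
proof (cases "x = real (Suc k) * h")
  case True
  thus ?thesis using assms by (simp add: cell_bubble_def)
next
  case False
  hence "real k \<le> x / h" "x / h < real k + 1"
    using assms by (auto simp: field_simps)
  hence "\<lfloor>x / h\<rfloor> = int k" by linarith
  hence "x = real k * h + frac (x / h) * h"
    using assms(1) by (simp add: frac_def field_simps)
  then obtain t where "x = real k * h + t * h" "frac (x / h) = t" by blast
  thus ?thesis by (simp add: cell_bubble_def algebra_simps power2_eq_square)
qed

text \<open>
  The right-hand side is \<open>h\<^sup>2/12\<close> times the integral of \<open>x + c\<close>: against affine functions, the bubble
  acts on whole cells like its mean. The proof adds one cell at a time.
\<close>
lemma has_integral_cell_bubble_moment:
  assumes "h > 0"
  shows "((\<lambda>x. cell_bubble h x * (x + c)) has_integral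
           h\<^sup>2 / 12 * ((real k * h)\<^sup>2 / 2 + c * (real k * h))) {0..real k * h}"
proof (induction k)
  case 0
  show ?case by (auto intro: has_integral_null)
next
  case (Suc k)
  define a where "a = real k * h"
  have b: "real (Suc k) * h = a + h" by (simp add: a_def algebra_simps)
  have a: "a \<ge> 0" using assms by (simp add: a_def)
  \<comment> \<open>an antiderivative on the next cell: with \<open>t = x - a\<close> the integrand is
    \<open>(h t - t\<^sup>2) (t + (a + c)) / 2\<close>\<close>
  define G where "G x = h * ((x-a)^3/3 + (a + c) * (x-a)^2/2) / 2
      - ((x-a)^4/4 + (a + c) * (x-a)^3/3) / 2" for x
  have "((\<lambda>x. (x - a) * (a + h - x) / 2 * (x + c)) has_integral G (a + h) - G a) {a..a + h}"
  proof (rule fundamental_theorem_of_calculus)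
    fix x
    show "(G has_vector_derivative (x - a) * (a + h - x) / 2 * (x + c)) (at x within {a..a + h})"
      unfolding G_def has_real_derivative_iff_has_vector_derivative[symmetric]
      by (auto intro!: derivative_eq_intros
          simp: field_simps power2_eq_square power3_eq_cube)
  qed (use assms in simp)
  also have "G (a + h) - G a = h\<^sup>2 / 12 * ((a + h)\<^sup>2 / 2 + c * (a + h)) - h\<^sup>2 / 12 * (a\<^sup>2 / 2 + c * a)"
    by (simp add: G_def field_simps power2_eq_square power3_eq_cube power4_eq_xxxx)
  finally have "((\<lambda>x. cell_bubble h x * (x + c)) has_integral
      h\<^sup>2 / 12 * ((a + h)\<^sup>2 / 2 + c * (a + h)) - h\<^sup>2 / 12 * (a\<^sup>2 / 2 + c * a)) {a..a + h}"
    by (rule has_integral_cong[THEN iffD1, rotated])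
       (use cell_bubble_on_cell[OF assms, of _ k] b in \<open>simp add: a_def\<close>)
  from has_integral_combine[OF a _ Suc.IH[folded a_def] this] show ?case
    using assms unfolding b by simp
qed


section \<open>The states as functions of the control\<close>

text \<open>
  Minus the derivative of the state with respect to the control, continuous and discrete alike.
\<close>
definition response :: "real \<Rightarrow> real \<Rightarrow> real" where
  "response \<alpha> x = x + 1 / \<alpha>"

text \<open>
  The distance of the state with zero control from the target.
\<close>
definition target_gap :: "real \<Rightarrow> real \<Rightarrow> real \<Rightarrow> real \<Rightarrow> real \<Rightarrow> real \<Rightarrow> real" where
  "target_gap x0 g b z \<alpha> x = - (1/2) * g * x\<^sup>2 + g * x0 * response \<alpha> x + b - z"

text \<open>
  The part of the discretization error that is linear in \<open>h\<close>, divided by \<open>g h\<close>. The summand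
  \<open>1/\<alpha>\<close> stems from the one-sided difference quotient in the Robin condition on the left edge.
\<close>
definition drift :: "real \<Rightarrow> real \<Rightarrow> real" where
  "drift \<alpha> x = x / 2 + 1 / \<alpha>"

text \<open>
  The continuous minus the discrete state, divided by \<open>g\<close>; it does not depend on the control.
\<close>
definition error_profile :: "real \<Rightarrow> real \<Rightarrow> real \<Rightarrow> real" where
  "error_profile \<alpha> h x = h * drift \<alpha> x + cell_bubble h x"

lemma bounded_measurable_response: "bounded_measurable a (response \<alpha>)"
  and bounded_measurable_target_gap: "bounded_measurable a (target_gap x0 g b z \<alpha>)"
  and bounded_measurable_drift: "bounded_measurable a (drift \<alpha>)"
  and bounded_measurable_error_profile: "bounded_measurable a (error_profile \<alpha> h)"
  unfolding error_profile_def[abs_def] target_gap_def[abs_def] response_def[abs_def]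
    drift_def[abs_def] divide_inverse
  by (intro bounded_measurable_intros bounded_measurable_cell_bubble)+

lemma state_minus_target:
  "state x0 g b \<alpha> q (x, y) - z = target_gap x0 g b z \<alpha> x - q * response \<alpha> x"
  by (simp add: state_def target_gap_def response_def algebra_simps diff_divide_distrib)

text \<open>
  In the cell with left end \<open>k h\<close>, the discrete minus the continuous state is
  \<open>g (x\<^sup>2/2 - (k+1) h x + k (k+1) h\<^sup>2/2 - h/\<alpha>)\<close>. The part quadratic in \<open>x\<close> equals
  \<open>(x - k h) (x - (k+1) h)/2 - h x/2\<close>, which is minus the bubble and minus the non-constant part of
  \<open>h\<close> times the drift.
\<close>
lemma discrete_state_minus_target:
  assumes "x0 > 0" "n \<ge> 1" "x \<in> {0<..<x0}"
  shows "discrete_state x0 g b \<alpha> q n (x, y) - z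
    = (target_gap x0 g b z \<alpha> x - g * error_profile \<alpha> (mesh x0 n) x) - q * response \<alpha> x"
proof -
  define h where "h = mesh x0 n"
  have h: "h > 0" "x0 = real n * h" using assms by (auto simp: h_def mesh_def)
  define k where "k = nat \<lfloor>x / h\<rfloor>"
  have "0 < x / h" "x / h < real n" using assms h by (auto simp: field_simps)
  hence k: "real k \<le> x / h" "x / h < real k + 1" "k < n"
    unfolding k_def by linarith+
  \<comment> \<open>cells are numbered from 1, so \<open>x\<close> lies in the cell number \<open>k + 1\<close>\<close>
  have cell: "x \<in> {real k * h..real (Suc k) * h}"
    using k h by (auto simp: field_simps)
  have "discrete_state x0 g b \<alpha> q n (x, y) = discrete_piece x0 g b \<alpha> q h (Suc k) x"
    unfolding h_def
    by (rule discrete_state_on_cell) (use assms k cell in \<open>auto simp: node_def h_def\<close>)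
  moreover have "discrete_piece x0 g b \<alpha> q h (Suc k) x - z
      = (target_gap x0 g b z \<alpha> x - g * error_profile \<alpha> h x) - q * response \<alpha> x"
    unfolding discrete_piece_def target_gap_def error_profile_def drift_def response_def
      cell_bubble_on_cell[OF h(1) cell] diff_divide_distrib
    by (simp add: algebra_simps power2_eq_square add_divide_distrib diff_divide_distrib)
  ultimately show ?thesis by (simp add: h_def)
qed

section \<open>Moments against the response\<close>

lemma integral_response_square:
  assumes "x0 > 0" "\<alpha> > 0"
  shows "integral_Ioo x0 (\<lambda>x. (response \<alpha> x)\<^sup>2) = x0 ^ 3 * D1 x0 \<alpha>"
proof -
  define G where "G x = x ^ 3 / 3 + x\<^sup>2 / \<alpha> + x / \<alpha>\<^sup>2" for x :: real
  have "((\<lambda>x. (response \<alpha> x)\<^sup>2) has_integral G x0 - G 0) {0..x0}"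
  proof (rule fundamental_theorem_of_calculus)
    fix x
    show "(G has_vector_derivative (response \<alpha> x)\<^sup>2) (at x within {0..x0})"
      unfolding G_def response_def has_real_derivative_iff_has_vector_derivative[symmetric]
      using assms by (auto intro!: derivative_eq_intros simp: field_simps power2_eq_square)
  qed (use assms in simp)
  moreover have "G x0 - G 0 = x0 ^ 3 * D1 x0 \<alpha>"
    using assms by (simp add: G_def D1_def field_simps power2_eq_square power3_eq_cube)
  ultimately show ?thesis
    by (simp add: integral_Ioo_eq_integral bounded_measurable_power bounded_measurable_response
        integral_unique)
qed

lemma integral_drift_response:
  assumes "x0 > 0" "\<alpha> > 0"
  shows "integral_Ioo x0 (\<lambda>x. drift \<alpha> x * response \<alpha> x)
    = x0 ^ 3 / 6 * (1 + 9 / (2 * \<alpha> * x0) + 6 / (\<alpha>\<^sup>2 * x0\<^sup>2))"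
proof -
  define G where "G x = x ^ 3 / 6 + 3 * x\<^sup>2 / (4 * \<alpha>) + x / \<alpha>\<^sup>2" for x :: real
  have "((\<lambda>x. drift \<alpha> x * response \<alpha> x) has_integral G x0 - G 0) {0..x0}"
  proof (rule fundamental_theorem_of_calculus)
    fix x
    show "(G has_vector_derivative drift \<alpha> x * response \<alpha> x) (at x within {0..x0})"
      unfolding G_def response_def drift_def has_real_derivative_iff_has_vector_derivative[symmetric]
      using assms by (auto intro!: derivative_eq_intros simp: field_simps power2_eq_square)
  qed (use assms in simp)
  moreover have "G x0 - G 0 = x0 ^ 3 / 6 * (1 + 9 / (2 * \<alpha> * x0) + 6 / (\<alpha>\<^sup>2 * x0\<^sup>2))"
    using assms by (simp add: G_def field_simps power2_eq_square power3_eq_cube)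
  ultimately show ?thesis
    by (simp add: integral_Ioo_eq_integral bounded_measurable_mult bounded_measurable_response
        bounded_measurable_drift integral_unique)
qed

lemma integral_cell_bubble_response:
  assumes "x0 > 0" "\<alpha> > 0" "n \<ge> 1"
  shows "integral_Ioo x0 (\<lambda>x. cell_bubble (mesh x0 n) x * response \<alpha> x)
    = (mesh x0 n)\<^sup>2 * x0\<^sup>2 / 24 * (1 + 2 / (\<alpha> * x0))"
proof -
  define h where "h = mesh x0 n"
  have h: "h > 0" "real n * h = x0" using assms by (auto simp: h_def mesh_def)
  have "integral_Ioo x0 (\<lambda>x. cell_bubble h x * response \<alpha> x)
      = h\<^sup>2 / 12 * (x0\<^sup>2 / 2 + 1 / \<alpha> * x0)"
    using has_integral_cell_bubble_moment[OF h(1), of "1 / \<alpha>" n]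
    by (simp add: integral_Ioo_eq_integral bounded_measurable_mult bounded_measurable_response
        bounded_measurable_cell_bubble integral_unique response_def[symmetric] h(2))
  also have "\<dots> = h\<^sup>2 * x0\<^sup>2 / 24 * (1 + 2 / (\<alpha> * x0))"
    using assms by (simp add: field_simps power2_eq_square)
  finally show ?thesis by (simp add: h_def)
qed

section \<open>First-order expansion\<close>

text \<open>
  Expanding the square leaves the remainder \<open>-2 g r bubble + g\<^sup>2 e\<^sup>2\<close> with \<open>e\<close> the error profile. The
  bubble is at most \<open>h\<^sup>2/8\<close> and \<open>e\<close> is at most a multiple of \<open>h\<close>, uniformly for \<open>h \<le> a\<close>, so the
  remainder is \<open>O(h\<^sup>2)\<close> pointwise.
\<close>
lemma perturbed_integral_square:
  assumes r: "bounded_measurable a r"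
  shows "\<exists>K. \<forall>h. 0 < h \<and> h \<le> a \<longrightarrow>
    \<bar>integral_Ioo a (\<lambda>x. (r x - g * error_profile \<alpha> h x)\<^sup>2)
      - integral_Ioo a (\<lambda>x. (r x)\<^sup>2)
      + 2 * g * h * integral_Ioo a (\<lambda>x. r x * drift \<alpha> x)\<bar> \<le> K * h\<^sup>2"
proof -
  obtain R where R: "\<And>x. x \<in> {0<..<a} \<Longrightarrow> \<bar>r x\<bar> \<le> R"
    using r by (auto simp: bounded_measurable_def simp del: greaterThanLessThan_iff)
  obtain D where D: "\<And>x. x \<in> {0<..<a} \<Longrightarrow> \<bar>drift \<alpha> x\<bar> \<le> D"
    using bounded_measurable_drift[of a \<alpha>]
    by (auto simp: bounded_measurable_def simp del: greaterThanLessThan_iff)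
  define C where "C = 2 * \<bar>g\<bar> * R / 8 + g\<^sup>2 * (D + a / 8)\<^sup>2"
  note bm = bounded_measurable_intros r bounded_measurable_cell_bubble bounded_measurable_drift
    bounded_measurable_error_profile
  show ?thesis
  proof (intro exI[of _ "a * C"] allI impI, elim conjE)
    fix h :: real
    assume h: "0 < h" "h \<le> a"
    define \<rho> where "\<rho> x = (- 2 * g) * (r x * cell_bubble h x)
      + g\<^sup>2 * (error_profile \<alpha> h x)\<^sup>2" for x
    have bm_\<rho>: "bounded_measurable a \<rho>" unfolding \<rho>_def[abs_def] by (intro bm)
    have sq: "(\<lambda>x. (r x - g * error_profile \<alpha> h x)\<^sup>2)
        = (\<lambda>x. ((r x)\<^sup>2 + (- 2 * g * h) * (r x * drift \<alpha> x)) + 1 * \<rho> x)"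
      by (simp add: \<rho>_def error_profile_def power2_eq_square algebra_simps)
    have split: "integral_Ioo a (\<lambda>x. (r x - g * error_profile \<alpha> h x)\<^sup>2)
        - integral_Ioo a (\<lambda>x. (r x)\<^sup>2)
        + 2 * g * h * integral_Ioo a (\<lambda>x. r x * drift \<alpha> x) = integral_Ioo a \<rho>"
      unfolding sq by (subst integral_Ioo_add_scaled, (intro bm bm_\<rho>)+)+ simp
    have bound: "\<bar>\<rho> x\<bar> \<le> C * h\<^sup>2" if x: "x \<in> {0<..<a}" for x
    proof -
      note bub = cell_bubble_bounds[of h x]
      have "\<bar>error_profile \<alpha> h x\<bar> \<le> h * \<bar>drift \<alpha> x\<bar> + \<bar>cell_bubble h x\<bar>"
        unfolding error_profile_def using h(1)
          abs_triangle_ineq[of "h * drift \<alpha> x" "cell_bubble h x"] by (simp add: abs_mult)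
      also have "\<dots> \<le> h * D + h * a / 8"
      proof (rule add_mono)
        show "h * \<bar>drift \<alpha> x\<bar> \<le> h * D" using D[OF x] h(1) by simp
        have "h\<^sup>2 \<le> h * a" using h by (simp add: power2_eq_square)
        thus "\<bar>cell_bubble h x\<bar> \<le> h * a / 8" using bub by simp
      qed
      also have "\<dots> = h * (D + a / 8)" by (simp add: algebra_simps)
      finally have "(error_profile \<alpha> h x)\<^sup>2 \<le> (h * (D + a / 8))\<^sup>2"
        using abs_le_square_iff order_trans[OF _ abs_ge_self] by blast
      hence "g\<^sup>2 * (error_profile \<alpha> h x)\<^sup>2 \<le> g\<^sup>2 * (h * (D + a / 8))\<^sup>2"
        by (rule mult_left_mono) simp
      hence e: "g\<^sup>2 * (error_profile \<alpha> h x)\<^sup>2 \<le> g\<^sup>2 * (D + a / 8)\<^sup>2 * h\<^sup>2"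
        unfolding power_mult_distrib by (simp only: mult_ac)
      have "\<bar>r x\<bar> * cell_bubble h x \<le> R * (h\<^sup>2 / 8)"
        using R[OF x] bub by (intro mult_mono) auto
      hence "2 * \<bar>g\<bar> * (\<bar>r x\<bar> * cell_bubble h x) \<le> 2 * \<bar>g\<bar> * (R * (h\<^sup>2 / 8))"
        by (intro mult_left_mono) auto
      hence "\<bar>(- 2 * g) * (r x * cell_bubble h x)\<bar> \<le> 2 * \<bar>g\<bar> * (R * (h\<^sup>2 / 8))"
        using bub by (simp add: abs_mult)
      hence "\<bar>\<rho> x\<bar> \<le> 2 * \<bar>g\<bar> * (R * (h\<^sup>2 / 8)) + g\<^sup>2 * (D + a / 8)\<^sup>2 * h\<^sup>2"
        unfolding \<rho>_def using e
        by (intro order_trans[OF abs_triangle_ineq] add_mono) simp_all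
      thus ?thesis by (simp add: C_def algebra_simps)
    qed
    have "\<bar>integral_Ioo a \<rho>\<bar> \<le> integral_Ioo a (\<lambda>x. \<bar>\<rho> x\<bar>)"
      using set_integral_norm_bound[OF set_integrable_bounded_measurable[OF bm_\<rho>]] by simp
    also have "\<dots> \<le> integral_Ioo a (\<lambda>_. C * h\<^sup>2)"
      using bound set_integrable_bounded_measurable[OF bounded_measurable_const]
        set_integrable_abs[OF set_integrable_bounded_measurable[OF bm_\<rho>]]
      by (intro set_integral_mono) auto
    also have "\<dots> = a * C * h\<^sup>2"
      using h by (simp add: set_lebesgue_integral_def)
    finally show "\<bar>integral_Ioo a (\<lambda>x. (r x - g * error_profile \<alpha> h x)\<^sup>2)
        - integral_Ioo a (\<lambda>x. (r x)\<^sup>2)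
        + 2 * g * h * integral_Ioo a (\<lambda>x. r x * drift \<alpha> x)\<bar> \<le> a * C * h\<^sup>2"
      unfolding split .
  qed
qed

text \<open>
  The reverse triangle inequality \<open>\<bar>\<bar>d\<bar> - \<bar>c h\<bar>\<bar> \<le> \<bar>d - c h\<bar>\<close> carries a signed expansion over to
  absolute values, also when \<open>c = 0\<close>.
\<close>
lemma abs_first_order_smallo:
  fixes d h :: "nat \<Rightarrow> real"
  assumes h: "\<And>n. n \<ge> 1 \<Longrightarrow> h n > 0" "h \<longlonglongrightarrow> 0"
    and d: "\<And>n. n \<ge> 1 \<Longrightarrow> \<bar>d n - c * h n\<bar> \<le> K * (h n)\<^sup>2"
  shows "(\<lambda>n. \<bar>d n\<bar> - \<bar>c\<bar> * h n) \<in> o[sequentially](h)"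
proof (rule smalloI_tendsto)
  show "eventually (\<lambda>n. h n \<noteq> 0) sequentially"
    using eventually_ge_at_top[of 1] by eventually_elim (use h(1) in force)
  have "eventually (\<lambda>n. norm ((\<bar>d n\<bar> - \<bar>c\<bar> * h n) / h n) \<le> K * h n) sequentially"
    using eventually_ge_at_top[of 1]
  proof eventually_elim
    case (elim n)
    have hn: "h n > 0" using h(1) elim by simp
    have "\<bar>\<bar>d n\<bar> - \<bar>c\<bar> * h n\<bar> \<le> \<bar>d n - c * h n\<bar>"
      using abs_triangle_ineq3[of "d n" "c * h n"] hn by (simp add: abs_mult)
    also have "\<dots> \<le> K * (h n)\<^sup>2" by (rule d[OF elim])
    finally show ?case using hn by (simp add: divide_le_eq power2_eq_square mult.assoc)
  qed
  moreover have "(\<lambda>n. K * h n) \<longlonglongrightarrow> 0" using tendsto_mult_right_zero[OF h(2)] .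
  ultimately show "((\<lambda>n. (\<bar>d n\<bar> - \<bar>c\<bar> * h n) / h n) \<longlongrightarrow> 0) sequentially"
    by (rule Lim_null_comparison)
qed

section \<open>Optimal controls and optimal costs\<close>

theorem lemma13:
  fixes x0 y0 g b z M \<alpha> :: real
  assumes "x0 > 0" and "y0 > 0" and "M > 0" and "\<alpha> > 0"
  shows "(\<forall>n::nat. n \<ge> 1 \<longrightarrow>
            discrete_opt_flux x0 y0 g b z M \<alpha> n =
              opt_flux x0 y0 g b z M \<alpha>
              - B1 x0 M \<alpha> * (g * mesh x0 n / 6)
              - B2 x0 M \<alpha> * (g * (mesh x0 n)\<^sup>2 / (24 * x0)))
       \<and> (\<exists>C8 C9 :: real.
            (\<lambda>n. \<bar>discrete_opt_flux x0 y0 g b z M \<alpha> n - opt_flux x0 y0 g b z M \<alpha>\<bar>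
                  - C8 * mesh x0 n)
              \<in> o[sequentially](\<lambda>n. mesh x0 n)
          \<and> (\<lambda>n. \<bar>discrete_cost x0 y0 g b z M \<alpha> n (discrete_opt_flux x0 y0 g b z M \<alpha> n)
                  - cost x0 y0 g b z M \<alpha> (opt_flux x0 y0 g b z M \<alpha>)\<bar>
                  - C9 * mesh x0 n)
              \<in> o[sequentially](\<lambda>n. mesh x0 n))"
proof -
  define h where "h = mesh x0"
  define r where "r = target_gap x0 g b z \<alpha>"
  define w where "w = response \<alpha>"
  define e where "e n = error_profile \<alpha> (h n)" for n
  define K where "K = D1 x0 \<alpha> + M / x0 ^ 3"
  define S where "S = x0 ^ 3 * K"
  define A where "A = integral_Ioo x0 (\<lambda>x. (r x)\<^sup>2)"
  define F where "F = integral_Ioo x0 (\<lambda>x. r x * w x)"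
  define A' where "A' n = integral_Ioo x0 (\<lambda>x. (r x - g * e n x)\<^sup>2)" for n
  define F' where "F' n = integral_Ioo x0 (\<lambda>x. (r x - g * e n x) * w x)" for n
  define T where "T = integral_Ioo x0 (\<lambda>x. r x * drift \<alpha> x)"
  have K_pos: "K > 0"
    using assms unfolding K_def D1_def by (intro add_pos_pos) auto
  hence S_pos: "S > 0" using assms by (simp add: S_def)
  have S_eq: "integral_Ioo x0 (\<lambda>x. (w x)\<^sup>2) + M = S"
    using assms by (simp add: w_def integral_response_square S_def K_def distrib_left)
  have h: "h n > 0" "h n \<le> x0" if "n \<ge> 1" for n
    using assms(1) that by (auto simp: h_def mesh_def divide_le_eq)
  have h_tendsto: "h \<longlonglongrightarrow> 0"
    unfolding h_def mesh_def[abs_def] by (rule lim_const_over_n)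
  have bm: "bounded_measurable x0 w" "bounded_measurable x0 r" "bounded_measurable x0 (e n)" for n
    by (simp_all add: w_def r_def e_def bounded_measurable_response bounded_measurable_target_gap
        bounded_measurable_error_profile)
  note bm' = bm bounded_measurable_intros bounded_measurable_drift bounded_measurable_cell_bubble

  have J: "cost x0 y0 g b z M \<alpha> q = y0/2 * (A - 2 * q * F + q\<^sup>2 * S)" for q
    unfolding cost_def A_def F_def S_eq[symmetric]
    by (rule tracking_cost_expand[OF assms(2) bm(2,1)])
       (simp add: state_minus_target r_def w_def)
  have J': "discrete_cost x0 y0 g b z M \<alpha> n q = y0/2 * (A' n - 2 * q * F' n + q\<^sup>2 * S)"
    if "n \<ge> 1" for n q
    unfolding discrete_cost_def A'_def F'_def S_eq[symmetric]
    by (rule tracking_cost_expand[OF assms(2) _ bm(1)], (intro bm')+)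
       (use assms(1) that in \<open>auto simp: discrete_state_minus_target domain_Omega_def
          r_def w_def e_def h_def\<close>)
  have y0: "y0 / 2 > 0" using assms by simp
  have opt: "opt_flux x0 y0 g b z M \<alpha> = F / S"
      "cost x0 y0 g b z M \<alpha> (F / S) = y0/2 * (A - F\<^sup>2 / S)"
    unfolding opt_flux_def using quadratic_arg_min[OF y0 S_pos J] by auto
  have opt': "discrete_opt_flux x0 y0 g b z M \<alpha> n = F' n / S"
      "discrete_cost x0 y0 g b z M \<alpha> n (F' n / S) = y0/2 * (A' n - (F' n)\<^sup>2 / S)"
    if "n \<ge> 1" for n
    unfolding discrete_opt_flux_def using quadratic_arg_min[OF y0 S_pos J'[OF that]] by auto

  \<comment> \<open>only the numerator \<open>F\<close> feels the discretization: the drift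
    contributes \<open>f1 h\<close> and the bubble \<open>f2 h\<^sup>2\<close>\<close>
  define f1 where "f1 = - g * (x0 ^ 3 / 6 * (1 + 9 / (2 * \<alpha> * x0) + 6 / (\<alpha>\<^sup>2 * x0\<^sup>2)))"
  define f2 where "f2 = - g * (x0\<^sup>2 / 24 * (1 + 2 / (\<alpha> * x0)))"
  have F': "F' n = F + f1 * h n + f2 * (h n)\<^sup>2" if n: "n \<ge> 1" for n
  proof -
    have eq: "(\<lambda>x. (r x - g * e n x) * w x)
        = (\<lambda>x. (r x * w x + (- g * h n) * (drift \<alpha> x * w x))
              + (- g) * (cell_bubble (h n) x * w x))"
      by (simp add: e_def error_profile_def algebra_simps)
    have "F' n = F
        + (- g * h n) * integral_Ioo x0 (\<lambda>x. drift \<alpha> x * w x)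
        + (- g) * integral_Ioo x0 (\<lambda>x. cell_bubble (h n) x * w x)"
      unfolding F'_def F_def eq by (subst integral_Ioo_add_scaled, (intro bm')+)+ simp
    thus ?thesis
      unfolding w_def h_def integral_drift_response[OF assms(1,4)]
        integral_cell_bubble_response[OF assms(1,4) n] f1_def f2_def
      by (simp only: divide_inverse mult_ac)
  qed
  have f1: "f1 / S = - B1 x0 M \<alpha> * g / 6"
  proof -
    have "- g * (x0 ^ 3 / 6 * c) / S = - (c * inverse K) * g / 6" for c
      using assms(1) K_pos by (simp add: S_def field_simps)
    thus ?thesis unfolding f1_def B1_def K_def[symmetric] .
  qed
  have f2: "f2 / S = - B2 x0 M \<alpha> * g / (24 * x0)"
  proof -
    have "- g * (x0\<^sup>2 / 24 * c) / S = - (c * inverse K) * g / (24 * x0)" for c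
      using assms(1) K_pos by (simp add: S_def field_simps power2_eq_square power3_eq_cube)
    thus ?thesis unfolding f2_def B2_def K_def[symmetric] .
  qed
  have flux: "F' n / S = F / S - B1 x0 M \<alpha> * (g * h n / 6)
      - B2 x0 M \<alpha> * (g * (h n)\<^sup>2 / (24 * x0))" if "n \<ge> 1" for n
  proof -
    have "F' n / S = F / S + f1 / S * h n + f2 / S * (h n)\<^sup>2"
      by (simp add: F'[OF that] add_divide_distrib)
    thus ?thesis unfolding f1 f2 by simp
  qed

  have flux_order: "(\<lambda>n. \<bar>discrete_opt_flux x0 y0 g b z M \<alpha> n - opt_flux x0 y0 g b z M \<alpha>\<bar>
      - \<bar>f1 / S\<bar> * h n) \<in> o[sequentially](h)"
  proof (rule abs_first_order_smallo[OF h(1) h_tendsto, where K = "\<bar>f2 / S\<bar>"])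
    fix n :: nat
    assume n: "n \<ge> 1"
    have "discrete_opt_flux x0 y0 g b z M \<alpha> n - opt_flux x0 y0 g b z M \<alpha> - f1 / S * h n
        = f2 / S * (h n)\<^sup>2"
      by (simp add: opt opt'[OF n] F'[OF n] add_divide_distrib)
    thus "\<bar>discrete_opt_flux x0 y0 g b z M \<alpha> n - opt_flux x0 y0 g b z M \<alpha> - f1 / S * h n\<bar>
        \<le> \<bar>f2 / S\<bar> * (h n)\<^sup>2"
      by (simp add: abs_mult)
  qed

  \<comment> \<open>\<open>A' - F'\<^sup>2/S\<close> to first order: \<open>A'\<close> contributes \<open>- 2 g T h\<close>, \<open>F'\<^sup>2\<close> contributes \<open>2 F f1 h\<close>\<close>
  obtain L where L: "\<And>n. n \<ge> 1 \<Longrightarrow> \<bar>A' n - A + 2 * g * h n * T\<bar> \<le> L * (h n)\<^sup>2"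
    using perturbed_integral_square[OF bm(2), of g \<alpha>] h
    unfolding A'_def A_def T_def e_def by blast
  define c where "c = y0/2 * (- 2 * g * T - 2 * F * f1 / S)"
  \<comment> \<open>a bound, by \<open>h \<le> x0\<close>, on the coefficient of \<open>h\<^sup>2\<close> in \<open>F'\<^sup>2\<close>, which itself still depends on \<open>h\<close>\<close>
  define R where "R = 2 * \<bar>F * f2\<bar> + (\<bar>f1\<bar> + \<bar>f2\<bar> * x0)\<^sup>2"
  have cost_order: "(\<lambda>n. \<bar>discrete_cost x0 y0 g b z M \<alpha> n (discrete_opt_flux x0 y0 g b z M \<alpha> n)
      - cost x0 y0 g b z M \<alpha> (opt_flux x0 y0 g b z M \<alpha>)\<bar> - \<bar>c\<bar> * h n) \<in> o[sequentially](h)"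
  proof (rule abs_first_order_smallo[OF h(1) h_tendsto, where K = "y0/2 * (L + R / S)"])
    fix n :: nat
    assume n: "n \<ge> 1"
    define k where "k = f1 + f2 * h n"
    define \<delta> where "\<delta> = A' n - A + 2 * g * h n * T"
    have "\<bar>k\<bar> \<le> \<bar>f1\<bar> + \<bar>f2\<bar> * h n"
      unfolding k_def using h(1)[OF n] abs_triangle_ineq[of f1 "f2 * h n"] by (simp add: abs_mult)
    also have "\<dots> \<le> \<bar>f1\<bar> + \<bar>f2\<bar> * x0"
      using h(2)[OF n] by (simp add: mult_left_mono)
    finally have "k\<^sup>2 \<le> (\<bar>f1\<bar> + \<bar>f2\<bar> * x0)\<^sup>2"
      using abs_le_square_iff order_trans[OF _ abs_ge_self] by blast
    hence coeff: "\<bar>2 * F * f2 + k\<^sup>2\<bar> \<le> R"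
      unfolding R_def using abs_triangle_ineq[of "2 * F * f2" "k\<^sup>2"] by (simp add: abs_mult)
    define p where "p = (2 * F * f2 + k\<^sup>2) / S"
    have "\<bar>p\<bar> \<le> R / S"
      using coeff S_pos by (simp add: p_def divide_right_mono)
    hence "\<bar>p * (h n)\<^sup>2\<bar> \<le> R / S * (h n)\<^sup>2"
      by (simp only: abs_mult abs_power2 mult_right_mono zero_le_power2)
    moreover have "\<bar>\<delta>\<bar> \<le> L * (h n)\<^sup>2" using L[OF n] by (simp add: \<delta>_def)
    ultimately have bound: "\<bar>\<delta> - p * (h n)\<^sup>2\<bar> \<le> (L + R / S) * (h n)\<^sup>2"
      using abs_triangle_ineq4[of \<delta> "p * (h n)\<^sup>2"] unfolding distrib_right by linarith
    have "(F' n)\<^sup>2 = F\<^sup>2 + 2 * F * f1 * h n + p * S * (h n)\<^sup>2"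
    proof -
      have "p * S = 2 * F * f2 + k\<^sup>2" using S_pos by (simp add: p_def)
      thus ?thesis
        unfolding F'[OF n] by (simp add: k_def power2_eq_square algebra_simps)
    qed
    hence "(F' n)\<^sup>2 / S = F\<^sup>2 / S + 2 * F * f1 / S * h n + p * (h n)\<^sup>2"
      using S_pos by (simp add: add_divide_distrib)
    hence "y0/2 * (A' n - (F' n)\<^sup>2 / S) - y0/2 * (A - F\<^sup>2 / S) - c * h n
        = y0/2 * (\<delta> - p * (h n)\<^sup>2)"
      by (simp add: c_def \<delta>_def algebra_simps)
    hence "\<bar>y0/2 * (A' n - (F' n)\<^sup>2 / S) - y0/2 * (A - F\<^sup>2 / S) - c * h n\<bar>
        = y0/2 * \<bar>\<delta> - p * (h n)\<^sup>2\<bar>"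
      using y0 by (simp only: abs_mult abs_of_pos)
    also have "\<dots> \<le> y0/2 * ((L + R / S) * (h n)\<^sup>2)"
      by (rule mult_left_mono[OF bound]) (use y0 in simp)
    finally show "\<bar>discrete_cost x0 y0 g b z M \<alpha> n (discrete_opt_flux x0 y0 g b z M \<alpha> n)
        - cost x0 y0 g b z M \<alpha> (opt_flux x0 y0 g b z M \<alpha>) - c * h n\<bar>
        \<le> y0/2 * (L + R / S) * (h n)\<^sup>2"
      by (simp only: opt opt'[OF n] mult.assoc)
  qed

  show ?thesis
    using flux flux_order cost_order unfolding h_def by (auto simp only: opt(1) opt'(1))
qed

end
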